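(* For an integer $n\ge2$, let $X^{\nearrow}_n$ and $X^{\searrow}_n$ be the numbers of up-to-zero and down-from-zero situations, respectively, on a random lattice path of random length $N'$ (as described in the context). Then for all $n\ge 2$, $$\mathbb{E}(X^{\nearrow}_n)=\frac{1}{2\binom n2}\sum_{n'=0}^{n-2}\sum_{m=1}^{n'}[m\text{ odd}]\frac{n'+1}{m}=\frac12H^{\mathrm{odd}}_{n-2}-\frac18+\frac{(-1)^n}{8(n-[n\text{ even}])}$$ and $$\mathbb{E}(X^{\searrow}_n)=\frac{1}{2\binom n2}\sum_{n'=0}^{n-2}\sum_{m=3}^{n'+1}[m\text{ odd}]\frac{n'+1}{m}=\mathbb{E}(X^{\nearrow}_n)-\frac12+\frac{1}{2(n-[n\text{ even}])}.$$ The corresponding generating functions are \begin{align*} \sum_{n\ge2}\mathbb{E}(X^{\nearrow}_n)z^n&=\frac{\operatorname{artanh}(z)}{2(1-z)}-\frac{z^2}{8(1-z)}-\frac{3z+5}{8}\operatorname{artanh}(z)+\frac18z,\\ \sum_{n\ge2}\mathbb{E}(X^{\searrow}_n)z^n&=\frac{\operatorname{artanh}(z)}{2(1-z)}-\frac{5z^2}{8(1-z)}+\frac{z-1}{8}\operatorname{artanh}(z)-\frac38z. \end{align*} Asymptotically, as $n\to\infty$, \begin{align*} \mathbb{E}(X^{\nearrow}_n)&=\frac14\log n+\frac{2\gamma+2\log2-1}{8}-\frac{3}{8n}-\frac{3[n\text{ even}]+1}{12n^2}-\frac{3[n\text{ even}]}{8n^3}+O\Bigl(\frac1{n^4}\Bigr),\\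 \mathbb{E}(X^{\searrow}_n)&=\frac14\log n+\frac{2\gamma+2\log2-5}{8}+\frac{1}{8n}+\frac{3[n\text{ even}]-1}{12n^2}+\frac{[n\text{ even}]}{8n^3}+O\Bigl(\frac1{n^4}\Bigr). \end{align*}
   Context: Notation: $[\mathit{expr}]$ is $1$ if $\mathit{expr}$ is true and $0$ otherwise; $H^{\mathrm{odd}}_n=\sum_{m=1}^n\frac{[m\text{ odd}]}{m}$; $\log$ is the natural logarithm; $\gamma$ is the Euler--Mascheroni constant; $\operatorname{artanh}(z)=\frac12(\log(1+z)-\log(1-z))=\sum_{m\text{ odd}}z^m/m$. Fixed-length random path model: for an integer $n'\ge0$, a random path of length $n'$ on $\mathbb{Z}^2$ with steps $(1,+1)$ and $(1,-1)$, ending in $(n',0)$, is chosen as follows: first choose a starting point $(0,S)$ with $S$ uniformly distributed in $\{-n',-n'+2,\dots,n'-2,n'\}$; then choose a path uniformly at random among all paths from $(0,S)$ to $(n',0)$. Variable-length model: fix $n\ge2$. Choose $(P,Q)$ with $1\le P<Q\le n$ uniformly at random from all $\binom n2$ possibilities, let $N'=n-1-(Q-P)$, and choose a path of length $N'$ according to the fixed-length model. An up-to-zero situation of a path is a point $(x,0)$ on the path such that $(x-1,-1)$ is also on the path. A down-from-zero situation is a point $(x,0)$ on the path such that $(x+1,-1)$ is also on the path. *)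

theory Defs
  imports
    "HOL-Probability.Probability"
    "HOL-Computational_Algebra.Formal_Power_Series"
    "HOL-Library.Landau_Symbols"
begin

(* A path is the list of the lattice points it visits, from left to right. *)

type_synonym path = "(int \<times> int) list"

definition lattice_step :: "int \<times> int \<Rightarrow> int \<times> int \<Rightarrow> bool" where
  "lattice_step a b \<longleftrightarrow> b = (fst a + 1, snd a + 1) \<or> b = (fst a + 1, snd a - 1)"

definition paths_from :: "nat \<Rightarrow> int \<Rightarrow> path set" where
  "paths_from m s = {p. p \<noteq> [] \<and> hd p = (0, s) \<and> last p = (int m, 0) \<and> successively lattice_step p}"

definition start_heights :: "nat \<Rightarrow> int set" where
  "start_heights m = (\<lambda>k. 2 * int k - int m) ` {0..m}"

definition fixed_length_path :: "nat \<Rightarrow> path pmf" where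
  "fixed_length_path m =
     do {
       s \<leftarrow> pmf_of_set (start_heights m);
       pmf_of_set (paths_from m s)
     }"

(* pmf_of_set is unspecified on the empty set, so this is meaningful only for n \<ge> 2. *)
definition random_path :: "nat \<Rightarrow> path pmf" where
  "random_path n =
     do {
       (p, q) \<leftarrow> pmf_of_set {(p, q). 1 \<le> p \<and> p < q \<and> q \<le> n};
       fixed_length_path (n - 1 - (q - p))
     }"

definition up_to_zero :: "path \<Rightarrow> nat" where
  "up_to_zero p = card {(x, y) \<in> set p. y = 0 \<and> (x - 1, -1) \<in> set p}"

definition down_from_zero :: "path \<Rightarrow> nat" where
  "down_from_zero p = card {(x, y) \<in> set p. y = 0 \<and> (x + 1, -1) \<in> set p}"

definition E_up :: "nat \<Rightarrow> real" where
  "E_up n = measure_pmf.expectation (random_path n) (\<lambda>p. real (up_to_zero p))"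

definition E_down :: "nat \<Rightarrow> real" where
  "E_down n = measure_pmf.expectation (random_path n) (\<lambda>p. real (down_from_zero p))"

definition H_odd :: "nat \<Rightarrow> real" where
  "H_odd n = (\<Sum>m=1..n. of_bool (odd m) / real m)"

definition fps_artanh :: "'a :: field_char_0 fps" where
  "fps_artanh = Abs_fps (\<lambda>m. of_bool (odd m) / of_nat m)"

end

(* Read from right to left, the fixed-length model is a Polya urn with one initial ball of each
   colour: the unread part of a path can be dropped without changing the distribution of the rest.
   Hence the expected number of up-to-zero situations grows by the probability of one boundary
   event when the length grows from m to m + 1, namely 1 / (2 (m + 1)) for even m and 0 otherwise,
   and it equals H_odd m / 2; down-from-zero situations behave in the same way.  Exactly n' + 1
   pairs (P, Q) give the length n', which leads to the double sums.  For the asymptotics,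
   H_odd (2 k) is compared with its expansion through the increments in k. *)

theory Submission
  imports Defs "HOL-Real_Asymp.Real_Asymp"
begin

section \<open>Recursive structure of the paths\<close>

text \<open>The starting height is uniform in every length, so for even m it is 0 with probability 1
  / (m + 1), and by symmetry the point prepended next lies at height -1 in half of these cases. This
  explains 1 / (2 (m + 1)). A down-from-zero situation can only be created when an odd length m
  grows to m + 1: the new start is 0 with probability 1 / (m + 2), and half of these paths step
  down. Paths carry absolute coordinates beginning in column 0, so extending one on the left means
  translating all its points; whether a situation arises at the seam depends only on the old and the
  new starting height, which makes the count additive. For each expectation the closed form is
  recast as a coefficient identity in \<open>H_odd\<close>, the coefficients of artanh and their
  shift. It holds for all n, including 0 and 1, and serves both the formal and the convergent
  series.\<close>

definition shift_right :: "int \<times> int \<Rightarrow> int \<times> int" where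
  "shift_right z = (fst z + 1, snd z)"

lemma inj_shift_right: "inj shift_right"
  by (auto simp: inj_def shift_right_def prod_eq_iff)

lemma lattice_step_shift_right [simp]: "lattice_step (shift_right a) (shift_right b) \<longleftrightarrow> lattice_step a b"
  by (auto simp: lattice_step_def shift_right_def prod_eq_iff)

lemma fst_last_path:
  assumes "successively lattice_step p" "p \<noteq> []"
  shows "fst (last p) = fst (hd p) + int (length p) - 1"
  using assms by (induction p rule: induct_list012) (auto simp: lattice_step_def)

lemma paths_from_0: "paths_from 0 s = (if s = 0 then {[(0, 0)]} else {})"
proof -
  have "p = [(0, 0)] \<and> s = 0" if "p \<in> paths_from 0 s" for p
  proof -
    from that have p: "p \<noteq> []" "hd p = (0, s)" "last p = (0, 0)" "successively lattice_step p"
      by (auto simp: paths_from_def)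
    with fst_last_path[of p] have "length p = 1" by simp
    with p show ?thesis by (cases p) auto
  qed
  then show ?thesis by (auto simp: paths_from_def)
qed

lemma paths_from_Suc:
  "paths_from (Suc m) s =
     (\<lambda>p. (0, s) # map shift_right p) ` (paths_from m (s - 1) \<union> paths_from m (s + 1))"
proof (intro equalityI subsetI)
  fix p assume "p \<in> paths_from (Suc m) s"
  then have p: "p \<noteq> []" "hd p = (0, s)" "last p = (1 + int m, 0)" "successively lattice_step p"
    by (auto simp: paths_from_def)
  then obtain q where q: "p = (0, s) # q" by (cases p) auto
  with p have "q \<noteq> []" by auto
  \<comment> \<open>The tail starts in column 1; moved back by one column it becomes a candidate for
    \<open>paths_from m\<close>.\<close>
  define r where "r = map (\<lambda>z. (fst z - 1, snd z)) q"
  have qr: "q = map shift_right r" by (simp add: r_def shift_right_def comp_def)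
  with \<open>q \<noteq> []\<close> have "r \<noteq> []" by simp
  from p q qr \<open>r \<noteq> []\<close>
  have r: "last r = (int m, 0)" "lattice_step (0, s) (shift_right (hd r))" "successively lattice_step r"
    by (auto simp: successively_Cons hd_map last_map successively_map)
       (auto simp: shift_right_def prod_eq_iff)
  have "hd r = (0, s - 1) \<or> hd r = (0, s + 1)"
    using r(2) by (cases "hd r") (auto simp: lattice_step_def shift_right_def)
  with r \<open>r \<noteq> []\<close> have "r \<in> paths_from m (s - 1) \<union> paths_from m (s + 1)"
    by (auto simp: paths_from_def)
  with q qr show "p \<in> (\<lambda>p. (0, s) # map shift_right p) ` (paths_from m (s - 1) \<union> paths_from m (s + 1))"
    by blast
next
  fix p assume "p \<in> (\<lambda>p. (0, s) # map shift_right p) ` (paths_from m (s - 1) \<union> paths_from m (s + 1))"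
  then show "p \<in> paths_from (Suc m) s"
    by (auto simp: paths_from_def successively_Cons hd_map last_map successively_map)
       (auto simp: shift_right_def lattice_step_def)
qed

lemma finite_paths_from [simp]: "finite (paths_from m s)"
  by (induction m arbitrary: s) (auto simp: paths_from_0 paths_from_Suc)

lemma paths_from_eq_empty: "\<bar>s\<bar> > int m \<Longrightarrow> paths_from m s = {}"
  by (induction m arbitrary: s) (auto simp: paths_from_0 paths_from_Suc)

lemma sum_paths_from_Suc:
  fixes F :: "path \<Rightarrow> 'a :: comm_monoid_add"
  shows "(\<Sum>p\<in>paths_from (Suc m) s. F p) =
    (\<Sum>p\<in>paths_from m (s - 1). F ((0, s) # map shift_right p)) +
    (\<Sum>p\<in>paths_from m (s + 1). F ((0, s) # map shift_right p))"
proof -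
  have "paths_from m (s - 1) \<inter> paths_from m (s + 1) = {}"
    by (auto simp: paths_from_def)
  moreover have "inj_on (\<lambda>p. (0, s) # map shift_right p) A" for A
    using inj_shift_right by (auto simp: inj_on_def inj_map_eq_map)
  ultimately show ?thesis
    unfolding paths_from_Suc by (subst sum.reindex) (auto simp: sum.union_disjoint)
qed

text \<open>Here k is the number of down-steps, as s equals down-steps minus up-steps, and splitting
  by the first step gives Pascal's rule. For k > m both sides vanish, so the right edge fits the
  rule and only k = 0 is treated apart.\<close>

lemma card_paths_from: "card (paths_from m (2 * int k - int m)) = m choose k"
proof (induction m arbitrary: k)
  case 0
  then show ?case by (cases k) (auto simp: paths_from_0)
next
  case (Suc m)
  have rec: "card (paths_from (Suc m) s) = card (paths_from m (s - 1)) + card (paths_from m (s + 1))"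
    for s
    using sum_paths_from_Suc[of "\<lambda>_. 1 :: nat" m s] by simp
  show ?case
  proof (cases k)
    case 0
    have "paths_from m (2 * int k - int (Suc m) - 1) = {}"
      by (rule paths_from_eq_empty) (simp add: 0)
    with Suc.IH[of 0] 0 show ?thesis by (simp add: rec)
  next
    case k: (Suc j)
    have "2 * int k - int (Suc m) - 1 = 2 * int j - int m"
         "2 * int k - int (Suc m) + 1 = 2 * int (Suc j) - int m"
      by (simp_all add: k)
    then have "card (paths_from (Suc m) (2 * int k - int (Suc m))) = (m choose j) + (m choose Suc j)"
      by (simp only: rec Suc.IH)
    then show ?thesis by (simp add: k)
  qed
qed

text \<open>Used at the seam between a prepended point and the old path: what is created there
  depends only on the two starting heights, because the old path has no further point in its first
  column.\<close>

lemma path_points: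
  assumes "p \<in> paths_from m s" "(x, y) \<in> set p"
  shows "x \<ge> 0" and "x = 0 \<longleftrightarrow> (x, y) = (0, s)"
  using assms
proof (induction m arbitrary: p s x y)
  case (Suc m)
  {
    case 1
    then show ?case
      by (fastforce simp: paths_from_Suc shift_right_def dest: Suc.IH(1))
  next
    case 2
    then show ?case
      by (fastforce simp: paths_from_Suc shift_right_def dest: Suc.IH(1))
  }
qed (auto simp: paths_from_0 split: if_splits)

lemma hd_in_path: "p \<in> paths_from m s \<Longrightarrow> (0, s) \<in> set p"
  unfolding paths_from_def by (metis (mono_tags, lifting) hd_in_set mem_Collect_eq)

lemma shift_right_in_set_map: "(x, y) \<in> set (map shift_right p) \<longleftrightarrow> (x - 1, y) \<in> set p"
  by (force simp: shift_right_def image_iff)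

lemma zero_height_in_path: "p \<in> paths_from m s \<Longrightarrow> (0, y) \<in> set p \<longleftrightarrow> y = s"
  using hd_in_path path_points(2) by blast

text \<open>Translation carries the old situations along. The prepended point lies in column 0 and
  has no predecessor, so it can only act as the predecessor (0, -1) of a situation at (1, 0), the
  translated old start.\<close>

lemma up_to_zero_Cons:
  assumes p: "p \<in> paths_from m t"
  shows "up_to_zero ((0, s) # map shift_right p) = up_to_zero p + of_bool (s = -1 \<and> t = 0)"
proof -
  let ?A = "{(x, y) \<in> set p. y = 0 \<and> (x - 1, -1) \<in> set p}"
  have "z \<in> {(x, y) \<in> set ((0, s) # map shift_right p). y = 0 \<and> (x - 1, -1) \<in> set ((0, s) # map shift_right p)} \<longleftrightarrow>
      z \<in> shift_right ` ?A \<union> (if s = -1 \<and> t = 0 then {(1, 0)} else {})" for z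
  proof (cases z)
    case (Pair x y)
    have A: "z \<in> shift_right ` ?A \<longleftrightarrow> (x - 1, 0) \<in> set p \<and> y = 0 \<and> (x - 2, -1) \<in> set p"
      using Pair by (force simp: shift_right_def image_iff)
    show ?thesis unfolding Un_iff A
      using Pair path_points(1)[OF p, of "x - 1" 0] path_points(1)[OF p, of "x - 2" "-1"]
        zero_height_in_path[OF p, of 0] zero_height_in_path[OF p, of "-1"]
      by (auto simp: shift_right_in_set_map simp del: set_map)
  qed
  then have "{(x, y) \<in> set ((0, s) # map shift_right p). y = 0 \<and> (x - 1, -1) \<in> set ((0, s) # map shift_right p)} =
      shift_right ` ?A \<union> (if s = -1 \<and> t = 0 then {(1, 0)} else {})"
    by (rule set_eqI)
  then have "up_to_zero ((0, s) # map shift_right p) =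
      card (shift_right ` ?A \<union> (if s = -1 \<and> t = 0 then {(1, 0)} else {}))"
    unfolding up_to_zero_def by (rule arg_cong)
  also have "\<dots> = card (shift_right ` ?A) + card (if s = -1 \<and> t = 0 then {(1::int, 0::int)} else {})"
  proof (rule card_Un_disjoint)
    show "finite (shift_right ` ?A)" by (rule finite_imageI, rule finite_subset[of _ "set p"]) auto
    \<comment> \<open>An old situation at (0, 0) would need a point in column -1, so (1, 0) is never
      a translated situation.\<close>
    show "shift_right ` ?A \<inter> (if s = -1 \<and> t = 0 then {(1, 0)} else {}) = {}"
      using path_points(1)[OF p, of "-1"] by (auto simp: shift_right_def)
  qed auto
  finally show ?thesis
    by (simp add: up_to_zero_def card_image inj_on_subset[OF inj_shift_right])
qed

text \<open>Now the new situation sits at the prepended point (0, 0) itself, with the old start as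
  its successor. Translated situations lie in columns at least 1, so it is not counted
  twice.\<close>

lemma down_from_zero_Cons:
  assumes p: "p \<in> paths_from m t"
  shows "down_from_zero ((0, s) # map shift_right p) = down_from_zero p + of_bool (s = 0 \<and> t = -1)"
proof -
  let ?A = "{(x, y) \<in> set p. y = 0 \<and> (x + 1, -1) \<in> set p}"
  have "z \<in> {(x, y) \<in> set ((0, s) # map shift_right p). y = 0 \<and> (x + 1, -1) \<in> set ((0, s) # map shift_right p)} \<longleftrightarrow>
      z \<in> shift_right ` ?A \<union> (if s = 0 \<and> t = -1 then {(0, 0)} else {})" for z
  proof (cases z)
    case (Pair x y)
    have A: "z \<in> shift_right ` ?A \<longleftrightarrow> (x - 1, 0) \<in> set p \<and> y = 0 \<and> (x, -1) \<in> set p"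
      using Pair by (force simp: shift_right_def image_iff)
    show ?thesis unfolding Un_iff A
      using Pair path_points(1)[OF p, of "x - 1" 0] path_points(1)[OF p, of "x" "-1"]
        zero_height_in_path[OF p, of 0] zero_height_in_path[OF p, of "-1"]
      by (auto simp: shift_right_in_set_map simp del: set_map)
  qed
  then have "{(x, y) \<in> set ((0, s) # map shift_right p). y = 0 \<and> (x + 1, -1) \<in> set ((0, s) # map shift_right p)} =
      shift_right ` ?A \<union> (if s = 0 \<and> t = -1 then {(0, 0)} else {})"
    by (rule set_eqI)
  then have "down_from_zero ((0, s) # map shift_right p) =
      card (shift_right ` ?A \<union> (if s = 0 \<and> t = -1 then {(0, 0)} else {}))"
    unfolding down_from_zero_def by (rule arg_cong)
  also have "\<dots> = card (shift_right ` ?A) + card (if s = 0 \<and> t = -1 then {(0::int, 0::int)} else {})"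
  proof (rule card_Un_disjoint)
    show "finite (shift_right ` ?A)" by (rule finite_imageI, rule finite_subset[of _ "set p"]) auto
    show "shift_right ` ?A \<inter> (if s = 0 \<and> t = -1 then {(0, 0)} else {}) = {}"
      using path_points(1)[OF p, of "-1" 0] by (auto simp: shift_right_def add_eq_0_iff2)
  qed auto
  finally show ?thesis
    by (simp add: down_from_zero_def card_image inj_on_subset[OF inj_shift_right])
qed

section \<open>Expectations\<close>

text \<open>The probability of each single path of length m with k down-steps. It is also the
  probability that the urn produces a prescribed sequence of m draws, k of them of one
  colour.\<close>

definition path_weight :: "nat \<Rightarrow> nat \<Rightarrow> real" where
  "path_weight m k = 1 / (real (m + 1) * real (m choose k))"

lemma path_weight_eq_fact:
  assumes "k \<le> m"
  shows "path_weight m k = fact k * fact (m - k) / fact (Suc m)"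
  using assms by (simp add: path_weight_def binomial_fact mult.commute)

(* The consistency relation of the Polya urn. *)
lemma path_weight_Suc:
  assumes "k \<le> m"
  shows "path_weight m k = path_weight (Suc m) k + path_weight (Suc m) (Suc k)"
proof -
  obtain j where m: "m = k + j" using assms le_Suc_ex by blast
  \<comment> \<open>After k down-steps and j up-steps the urn holds k + 1 and j + 1 balls; the two
    factors are the conditional probabilities of prepending an up-step and a down-step.\<close>
  have "path_weight (Suc m) k = real (j + 1) / real (k + j + 2) * path_weight m k"
    by (simp add: m path_weight_eq_fact Suc_diff_le)
  moreover have "path_weight (Suc m) (Suc k) = real (k + 1) / real (k + j + 2) * path_weight m k"
    by (simp add: m path_weight_eq_fact)
  moreover have "real (j + 1) + real (k + 1) = real (k + j + 2)" "real (k + j + 2) \<noteq> 0"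
    by simp_all
  then have "real (j + 1) / real (k + j + 2) + real (k + 1) / real (k + j + 2) = 1"
    by (metis add_divide_distrib divide_self)
  ultimately show ?thesis
    by (metis distrib_right mult_1)
qed

lemma sum_start_heights:
  "(\<Sum>s\<in>start_heights m. g s) = (\<Sum>k\<le>m. g (2 * int k - int m))"
  unfolding start_heights_def by (subst sum.reindex) (auto simp: inj_on_def atMost_atLeast0)

lemma paths_from_nonempty:
  assumes "s \<in> start_heights m"
  shows "paths_from m s \<noteq> {}"
proof -
  obtain k where "k \<le> m" "s = 2 * int k - int m"
    using assms by (auto simp: start_heights_def)
  then have "card (paths_from m s) > 0"
    by (simp add: card_paths_from)
  then show ?thesis by auto
qed

lemma finite_set_fixed_length_path: "finite (set_pmf (fixed_length_path m))"
  using paths_from_nonempty[of _ m]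
  by (auto simp: fixed_length_path_def start_heights_def)

definition fixed_length_mean :: "(path \<Rightarrow> real) \<Rightarrow> nat \<Rightarrow> real" where
  "fixed_length_mean F m = measure_pmf.expectation (fixed_length_path m) F"

lemma fixed_length_mean_eq:
  "fixed_length_mean F m =
     (\<Sum>k\<le>m. path_weight m k * (\<Sum>p\<in>paths_from m (2 * int k - int m). F p))"
proof -
  have card: "card (start_heights m) = m + 1"
    using sum_start_heights[of "\<lambda>_. 1::nat" m] by simp
  have fin: "finite (start_heights m)" "start_heights m \<noteq> {}"
    by (auto simp: start_heights_def)
  have "fixed_length_mean F m =
      (\<Sum>s\<in>start_heights m. measure_pmf.expectation (pmf_of_set (paths_from m s)) F /\<^sub>R real (m + 1))"
    unfolding fixed_length_mean_def fixed_length_path_def using paths_from_nonempty fin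
    by (subst pmf_expectation_bind_pmf_of_set) (auto simp: card)
  also have "\<dots> = (\<Sum>s\<in>start_heights m. (\<Sum>p\<in>paths_from m s. F p) / (real (card (paths_from m s)) * real (m + 1)))"
    using paths_from_nonempty by (intro sum.cong refl) (auto simp: integral_pmf_of_set field_simps)
  also have "\<dots> = (\<Sum>k\<le>m. path_weight m k * (\<Sum>p\<in>paths_from m (2 * int k - int m). F p))"
    unfolding sum_start_heights card_paths_from by (simp add: path_weight_def mult.commute)
  finally show ?thesis .
qed

text \<open>An old path occurs in two extensions whose weights add up to its old weight, so the old
  mean reappears. What remains is the probability of the seam event: the weight of a path starting
  at \<open>a\<close> times the number of continuations from \<open>b\<close>. As \<open>a\<close>
  and \<open>b\<close> differ by 1, this event occurs in exactly one of the two branches.\<close>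

lemma fixed_length_mean_Suc:
  assumes F: "\<And>s t p. p \<in> paths_from m t \<Longrightarrow>
      F ((0, s) # map shift_right p) = F p + of_bool (s = a \<and> t = b)"
    and ab: "\<bar>a - b\<bar> = 1"
  shows "fixed_length_mean F (Suc m) = fixed_length_mean F m +
    (\<Sum>k\<le>Suc m. of_bool (2 * int k - int (Suc m) = a) * path_weight (Suc m) k) * real (card (paths_from m b))"
proof -
  define T where "T s = (\<Sum>p\<in>paths_from m s. F p)" for s
  define c where "c = real (card (paths_from m b))"
  have step: "(\<Sum>p\<in>paths_from (Suc m) s. F p) = T (s - 1) + T (s + 1) + of_bool (s = a) * c" for s
    using ab by (auto simp: sum_paths_from_Suc F sum.distrib T_def c_def abs_if split: if_splits)
  let ?w = "path_weight (Suc m)"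
  \<comment> \<open>These are the heights -(m + 2) and m + 2, out of reach in m steps. Without them
    both sums run over k \<le> m, one of them after an index shift.\<close>
  have out: "T (2 * int 0 - int (Suc m) - 1) = 0" "T (2 * int (Suc m) - int (Suc m) + 1) = 0"
    unfolding T_def by (subst paths_from_eq_empty; simp)+
  have "fixed_length_mean F (Suc m) =
      (\<Sum>k\<le>Suc m. ?w k * T (2 * int k - int (Suc m) - 1)) +
      (\<Sum>k\<le>Suc m. ?w k * T (2 * int k - int (Suc m) + 1)) +
      (\<Sum>k\<le>Suc m. of_bool (2 * int k - int (Suc m) = a) * ?w k) * c"
    unfolding fixed_length_mean_eq step
    by (simp only: sum.distrib[symmetric] sum_distrib_right) (intro sum.cong refl, algebra)
  also have "(\<Sum>k\<le>Suc m. ?w k * T (2 * int k - int (Suc m) - 1)) =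
      (\<Sum>k\<le>m. ?w (Suc k) * T (2 * int k - int m))"
    using out(1) by (subst sum.atMost_Suc_shift) (simp add: algebra_simps)
  also have "(\<Sum>k\<le>Suc m. ?w k * T (2 * int k - int (Suc m) + 1)) =
      (\<Sum>k\<le>m. ?w k * T (2 * int k - int m))"
    using out(2) by (subst sum.atMost_Suc) (simp add: algebra_simps)
  also have "(\<Sum>k\<le>m. ?w (Suc k) * T (2 * int k - int m)) + (\<Sum>k\<le>m. ?w k * T (2 * int k - int m)) =
      fixed_length_mean F m"
    unfolding fixed_length_mean_eq sum.distrib[symmetric] T_def[symmetric]
    by (intro sum.cong refl) (simp add: path_weight_Suc[of _ m] algebra_simps)
  finally show ?thesis by (simp add: c_def)
qed

text \<open>A path of length 2j starts at height 0 with probability 1 / (2j + 1), and its two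
  extensions to the left are equally likely.\<close>

lemma central_path_weight:
  "path_weight (2 * j + 1) (j + 1) * real (2 * j choose j) = 1 / (2 * real (2 * j + 1))"
proof -
  define F where "F = (fact (2 * j) :: real)"
  define G where "G = (fact j :: real)"
  have pos: "F > 0" "G > 0" by (simp_all add: F_def G_def)
  have w: "path_weight (2 * j + 1) (j + 1) =
      (real j + 1) * G * G / (2 * (real j + 1) * real (2 * j + 1) * F)"
    by (simp add: path_weight_eq_fact F_def G_def ac_simps)
  have c: "real (2 * j choose j) = F / (G * G)"
    by (simp add: binomial_fact F_def G_def)
  have "a * G * G / (2 * a * b * F) * (F / (G * G)) = 1 / (2 * b)" if "a > 0" "b > 0" for a b :: real
    using pos that by (simp add: field_simps)
  from this[of "real j + 1" "real (2 * j + 1)"] show ?thesis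
    unfolding w c by simp
qed

text \<open>A path of length 2j + 2 starts at height 0 with probability 1 / (2j + 3). By reflection
  half of these paths step down, which leaves \<open>2 * j + 1 choose j\<close> continuations from
  -1.\<close>

lemma central_path_weight':
  "path_weight (2 * j + 2) (j + 1) * real (2 * j + 1 choose j) = 1 / (2 * real (2 * j + 3))"
proof -
  define F where "F = (fact (2 * j + 1) :: real)"
  define G where "G = (fact j :: real)"
  have pos: "F > 0" "G > 0" by (simp_all add: F_def G_def)
  have "path_weight (2 * j + 2) (j + 1) = fact (j + 1) * fact (j + 1) / fact (Suc (Suc (2 * j + 1)))"
    by (simp add: path_weight_eq_fact)
  then have w: "path_weight (2 * j + 2) (j + 1) =
      (real j + 1) * G * ((real j + 1) * G) / (real (2 * j + 3) * (2 * (real j + 1) * F))"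
    unfolding fact_Suc[of "Suc (2 * j + 1)"] fact_Suc[of "2 * j + 1"] F_def G_def
    by (simp add: ac_simps)
  have c: "real (2 * j + 1 choose j) = F / (G * ((real j + 1) * G))"
    using binomial_fact[of j "2 * j + 1", where 'a = real] by (simp add: F_def G_def)
  have "a * G * (a * G) / (b * (2 * a * F)) * (F / (G * (a * G))) = 1 / (2 * b)"
    if "a > 0" "b > 0" for a b :: real
    using pos that by (simp add: field_simps)
  from this[of "real j + 1" "real (2 * j + 3)"] show ?thesis
    unfolding w c by simp
qed

lemma sum_of_bool_single:
  assumes "finite A" "\<And>k. k \<in> A \<Longrightarrow> P k \<longleftrightarrow> k = j"
  shows "(\<Sum>k\<in>A. of_bool (P k) * f k) = of_bool (j \<in> A) * (f j :: real)"
proof -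
  have "(\<Sum>k\<in>A. of_bool (P k) * f k) = (\<Sum>k\<in>A. if k = j then f k else 0)"
    using assms(2) by (intro sum.cong) auto
  then show ?thesis using assms(1) by auto
qed

lemma mean_up_to_zero:
  "fixed_length_mean (\<lambda>p. real (up_to_zero p)) m = H_odd m / 2"
proof (induction m)
  case 0
  show ?case by (simp add: fixed_length_mean_eq paths_from_0 up_to_zero_def H_odd_def)
next
  case (Suc m)
  have "(\<Sum>k\<le>Suc m. of_bool (2 * int k - int (Suc m) = -1) * path_weight (Suc m) k) *
      real (card (paths_from m 0)) = of_bool (even m) / (2 * real (Suc m))"
  proof (cases "even m")
    case True
    then obtain j where m: "m = 2 * j" by blast
    have "(\<Sum>k\<le>Suc m. of_bool (2 * int k - int (Suc m) = -1) * path_weight (Suc m) k) =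
        of_bool (j \<in> {..Suc m}) * path_weight (Suc m) j"
      by (rule sum_of_bool_single) (auto simp: m)
    \<comment> \<open>Height -1 belongs to index j, whereas \<open>central_path_weight\<close>
      speaks of j + 1; exchanging the colours of the urn identifies the two weights.\<close>
    moreover have "path_weight (Suc m) j = path_weight (Suc m) (Suc j)"
      by (simp add: m path_weight_eq_fact Suc_diff_le)
    moreover have "card (paths_from m 0) = m choose j"
      using card_paths_from[of m j] by (simp add: m)
    ultimately show ?thesis
      using central_path_weight[of j] by (simp add: m)
  next
    case False
    then have "2 * int k - int (Suc m) \<noteq> -1" for k by presburger
    then show ?thesis using False by simp
  qed
  moreover have "fixed_length_mean (\<lambda>p. real (up_to_zero p)) (Suc m) =
      fixed_length_mean (\<lambda>p. real (up_to_zero p)) m +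
      (\<Sum>k\<le>Suc m. of_bool (2 * int k - int (Suc m) = -1) * path_weight (Suc m) k) *
      real (card (paths_from m 0))"
    by (rule fixed_length_mean_Suc) (auto simp: up_to_zero_Cons)
  moreover have "H_odd (Suc m) = H_odd m + of_bool (even m) / real (Suc m)"
    by (simp add: H_odd_def)
  ultimately show ?case
    by (simp only: Suc.IH) (simp add: add_divide_distrib mult.commute)
qed

text \<open>Growth from m to m + 1 contributes 1 / (2 (m + 2)) for odd m, so the denominators are 3,
  5, 7 and so on. The first term of \<open>H_odd\<close> never occurs, hence the shifted index and
  the subtracted 1.\<close>

lemma mean_down_from_zero:
  "fixed_length_mean (\<lambda>p. real (down_from_zero p)) m = (H_odd (m + 1) - 1) / 2"
proof (induction m)
  case 0
  show ?case by (simp add: fixed_length_mean_eq paths_from_0 down_from_zero_def H_odd_def)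
next
  case (Suc m)
  have "(\<Sum>k\<le>Suc m. of_bool (2 * int k - int (Suc m) = 0) * path_weight (Suc m) k) *
      real (card (paths_from m (-1))) = of_bool (odd m) / (2 * real (Suc (Suc m)))"
  proof (cases "odd m")
    case True
    then obtain j where m: "m = 2 * j + 1" by (blast elim: oddE)
    have "(\<Sum>k\<le>Suc m. of_bool (2 * int k - int (Suc m) = 0) * path_weight (Suc m) k) =
        of_bool (j + 1 \<in> {..Suc m}) * path_weight (Suc m) (j + 1)"
      by (rule sum_of_bool_single) (auto simp: m)
    moreover have "card (paths_from m (-1)) = m choose j"
      using card_paths_from[of m j] by (simp add: m)
    ultimately show ?thesis
      using central_path_weight'[of j] by (simp add: m)
  next
    case False
    then have "2 * int k - int (Suc m) \<noteq> 0" for k by presburger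
    then show ?thesis using False by simp
  qed
  moreover have "fixed_length_mean (\<lambda>p. real (down_from_zero p)) (Suc m) =
      fixed_length_mean (\<lambda>p. real (down_from_zero p)) m +
      (\<Sum>k\<le>Suc m. of_bool (2 * int k - int (Suc m) = 0) * path_weight (Suc m) k) *
      real (card (paths_from m (-1)))"
    by (rule fixed_length_mean_Suc) (auto simp: down_from_zero_Cons)
  moreover have "H_odd (Suc m + 1) = H_odd (m + 1) + of_bool (odd m) / real (Suc (Suc m))"
    by (simp add: H_odd_def)
  ultimately show ?case
    by (simp only: Suc.IH) (simp add: add_divide_distrib diff_divide_distrib mult.commute)
qed

section \<open>The variable-length model\<close>

lemma sum_pairs_by_difference:
  fixes g :: "nat \<Rightarrow> real"
  shows "(\<Sum>(p, q)\<in>{(p, q). 1 \<le> p \<and> p < q \<and> q \<le> n}. g (n - 1 - (q - p))) =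
    (\<Sum>m<n - 1. real (m + 1) * g m)"
proof -
  have "(\<Sum>(p, q)\<in>{(p, q). 1 \<le> p \<and> p < q \<and> q \<le> n}. g (n - 1 - (q - p))) =
      (\<Sum>(m, p)\<in>(SIGMA m:{..<n - 1}. {1..m + 1}). g m)"
    \<comment> \<open>A given m forces q = p + (n - 1 - m), and q \<le> n leaves exactly the values
      1, ..., m + 1 for p.\<close>
    by (rule sum.reindex_bij_witness[of _ "\<lambda>(m, p). (p, p + (n - 1 - m))" "\<lambda>(p, q). (n - 1 - (q - p), p)"])
       auto
  also have "\<dots> = (\<Sum>m<n - 1. real (m + 1) * g m)"
    by (subst sum.Sigma[symmetric]) auto
  finally show ?thesis .
qed

lemma sum_Suc_eq_choose_two: "(\<Sum>m<n. real (m + 1)) = real (Suc n choose 2)"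
  by (induction n) (auto simp: numeral_2_eq_2)

lemma expectation_random_path:
  assumes "n \<ge> 2"
  shows "measure_pmf.expectation (random_path n) F =
    1 / real (n choose 2) * (\<Sum>m=0..n-2. real (m + 1) * fixed_length_mean F m)"
proof -
  let ?A = "{(p, q). 1 \<le> p \<and> p < q \<and> q \<le> n}"
  have idx: "{0..n - 2} = {..<n - 1}" using assms by auto
  have fin: "finite ?A" by (rule finite_subset[of _ "{..n} \<times> {..n}"]) auto
  have "(1, 2) \<in> ?A" using assms by simp
  then have ne: "?A \<noteq> {}" by blast
  have "real (card ?A) = (\<Sum>m<n - 1. real (m + 1))"
    using sum_pairs_by_difference[of "\<lambda>_. 1" n] by (simp add: case_prod_beta)
  also have "\<dots> = real (Suc (n - 1) choose 2)"
    by (rule sum_Suc_eq_choose_two)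
  also have "\<dots> = real (n choose 2)"
    using assms by simp
  finally have card: "real (card ?A) = real (n choose 2)" .
  have "measure_pmf.expectation (random_path n) F =
      (\<Sum>a\<in>?A. (case a of (p, q) \<Rightarrow> fixed_length_mean F (n - 1 - (q - p))) /\<^sub>R real (card ?A))"
    unfolding random_path_def fixed_length_mean_def using fin ne finite_set_fixed_length_path
    by (subst pmf_expectation_bind_pmf_of_set) (auto intro!: sum.cong)
  also have "\<dots> = (\<Sum>(p, q)\<in>?A. fixed_length_mean F (n - 1 - (q - p))) / real (card ?A)"
    by (simp add: sum_divide_distrib case_prod_beta field_simps)
  also have "\<dots> = 1 / real (n choose 2) * (\<Sum>m=0..n-2. real (m + 1) * fixed_length_mean F m)"
    by (simp only: sum_pairs_by_difference idx card) simp
  finally show ?thesis .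
qed

section \<open>Odd harmonic numbers\<close>

lemma H_odd_0 [simp]: "H_odd 0 = 0"
  by (simp add: H_odd_def)

lemma H_odd_Suc: "H_odd (Suc n) = H_odd n + of_bool (odd (Suc n)) / real (Suc n)"
  by (simp add: H_odd_def)

lemma H_odd_minus_1: "(\<Sum>m=3..n+1. of_bool (odd m) / real m) = H_odd (n + 1) - 1"
  by (induction n) (auto simp: H_odd_Suc)

lemma real_choose_two: "real (n + 2 choose 2) = real (n + 2) * real (n + 1) / 2"
proof (induction n)
  case (Suc n)
  have "(Suc n + 2 choose 2) = (n + 2 choose 2) + (n + 2)"
    by (simp add: numeral_2_eq_2)
  then have "real (Suc n + 2 choose 2) = real (n + 2) * real (n + 1) / 2 + real (n + 2)"
    by (simp only: of_nat_add Suc.IH)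
  then show ?case by (simp add: field_simps)
qed (simp add: numeral_2_eq_2)

text \<open>The closed form comes from exchanging summations: the term 1/i is multiplied by the sum
  of m + 1 over i \<le> m \<le> n, which is \<open>(n + 2 choose 2) - (i + 1 choose 2)\<close>. So
  the sum of (i + 1) / 2 over odd i \<le> n is subtracted from
  \<open>(n + 2 choose 2) * H_odd n\<close>; it is a triangular number, and dividing it by
  \<open>n + 2 choose 2\<close> gives 1/4 up to the parity term. With the form known, induction
  suffices.\<close>

lemma sum_weighted_H_odd:
  "(\<Sum>m=0..n. real (m + 1) * H_odd m) =
    real (n + 2 choose 2) * (H_odd n - 1/4 + (-1) ^ n / (4 * (real (n + 2) - of_bool (even n))))"
proof (induction n)
  case (Suc n)
  have step: "(\<Sum>m=0..Suc n. real (m + 1) * H_odd m) =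
      (\<Sum>m=0..n. real (m + 1) * H_odd m) + real (n + 2) * H_odd (Suc n)"
    by simp
  define x where "x = real n"
  have x: "real (n + 2) = x + 2" "real (n + 1) = x + 1" "real (Suc n) = x + 1"
    "real (Suc n + 2) = x + 3" "real (Suc n + 1) = x + 2"
    by (simp_all add: x_def)
  have nz: "x + 1 \<noteq> 0" "x + 2 \<noteq> 0" "x + 3 \<noteq> 0"
    by (simp_all add: x_def add_nonneg_eq_0_iff)
  show ?case
  proof (cases "even n")
    case True
    then have b: "(-1 :: real) ^ n = 1" "(-1 :: real) ^ Suc n = -1" "of_bool (even n) = (1 :: real)"
      "of_bool (even (Suc n)) = (0 :: real)" "of_bool (odd (Suc n)) = (1 :: real)"
      by simp_all
    \<comment> \<open>Keeping h, p and q free makes this a polynomial identity. At p = 1 / (x + 1)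
      and q = 1 / (x + 3) the bracket on the right becomes -3 + 2 + 1 = 0.\<close>
    have "(x + 2) * (x + 1) / 2 * (h - 1/4 + p / 4) + (x + 2) * (h + p) -
        (x + 3) * (x + 2) / 2 * (h + p - 1/4 - q / 4) =
        (x + 2) * (- 3 * ((x + 1) * p) + 2 + (x + 3) * q) / 8" for h p q
      by (simp add: field_simps)
    from this[of _ "1 / (x + 1)" "1 / (x + 3)"]
    have "(x + 2) * (x + 1) / 2 * (h - 1/4 + 1 / (4 * (x + 2 - 1))) + (x + 2) * (h + 1 / (x + 1)) =
        (x + 3) * (x + 2) / 2 * (h + 1 / (x + 1) - 1/4 + -1 / (4 * (x + 3 - 0)))" for h
      using nz by (simp add: mult.commute[of x 4] add.commute[of 4 "4 * x"])
    then show ?thesis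
      unfolding step Suc.IH real_choose_two H_odd_Suc x b .
  next
    case False
    then have b: "(-1 :: real) ^ n = -1" "(-1 :: real) ^ Suc n = 1" "of_bool (even n) = (0 :: real)"
      "of_bool (even (Suc n)) = (1 :: real)" "of_bool (odd (Suc n)) = (0 :: real)"
      by simp_all
    have "(x + 2) * (x + 1) / 2 * (h - 1/4 - p / 4) + (x + 2) * h -
        (x + 3) * (x + 2) / 2 * (h - 1/4 + p / 4) = (x + 2) * (1 - (x + 2) * p) / 4" for h p
      by (simp add: field_simps)
    from this[of _ "1 / (x + 2)"]
    have "(x + 2) * (x + 1) / 2 * (h - 1/4 + -1 / (4 * (x + 2 - 0))) + (x + 2) * (h + 0 / (x + 1)) =
        (x + 3) * (x + 2) / 2 * (h + 0 / (x + 1) - 1/4 + 1 / (4 * (x + 3 - 1)))" for h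
      using nz by (simp add: mult.commute[of x 4] add.commute[of 4 "4 * x"])
    then show ?thesis
      unfolding step Suc.IH real_choose_two H_odd_Suc x b .
  qed
qed simp

lemma sum_even_indicator: "(\<Sum>m=0..n. of_bool (even m) :: real) = real (n div 2) + 1"
  by (induction n) auto

section \<open>Generating functions\<close>

lemma fps_divide_const_one_minus_X:
  fixes f :: "'a :: field fps"
  assumes "c \<noteq> 0"
  shows "f / (fps_const c * (1 - fps_X)) = fps_const (1 / c) * (f / (1 - fps_X))"
proof -
  have "f / (fps_const c * (1 - fps_X)) = f * inverse (fps_const c * (1 - fps_X))"
    using assms by (intro fps_divide_unit) simp
  also have "inverse (fps_const c * (1 - fps_X)) = fps_const (1 / c) * inverse (1 - fps_X)"
    using assms by (simp only: fps_inverse_mult fps_const_inverse inverse_eq_divide[of c])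
  also have "f * \<dots> = fps_const (1 / c) * (f / (1 - fps_X))"
    by (subst fps_divide_unit) (simp_all only: mult.left_commute, simp)
  finally show ?thesis .
qed

text \<open>Division by 1 - X forms partial sums, which turns artanh into the series of
  \<open>H_odd\<close>; multiplication by X shifts the index, and \<open>d\<close> repairs the
  coefficient at n = 1. The truncated n - 1 at n = 0 is harmless, since 0 is not odd.\<close>

lemma Abs_fps_H_odd:
  assumes e: "\<And>n. (if n \<ge> 2 then e n else 0) =
      H_odd n / 2 + a * of_bool (n \<ge> 2) + b * (of_bool (odd (n - 1)) / real (n - 1)) +
      c * (of_bool (odd n) / real n) + d * of_bool (n = 1)"
  shows "Abs_fps (\<lambda>n. if n \<ge> 2 then e n else 0) =
    fps_artanh / (2 * (1 - fps_X)) + fps_const a * (fps_X ^ 2 / (1 - fps_X)) +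
      (fps_const b * fps_X + fps_const c) * fps_artanh + fps_const d * fps_X"
proof (rule fps_ext)
  fix n
  have "fps_artanh / (2 * (1 - fps_X)) = fps_const (1 / 2) * (fps_artanh / (1 - fps_X :: real fps))"
    using fps_divide_const_one_minus_X[of 2 "fps_artanh :: real fps"] by (simp add: numeral_fps_const)
  moreover have "(\<Sum>i=0..n. fps_nth fps_artanh i) = H_odd n"
    by (simp add: H_odd_def fps_artanh_def sum.atLeast_Suc_atMost)
  moreover have "(\<Sum>i=0..n. fps_nth (fps_X ^ 2 :: real fps) i) = of_bool (n \<ge> 2)"
    by (simp add: fps_X_power_nth)
  ultimately show "fps_nth (Abs_fps (\<lambda>n. if n \<ge> 2 then e n else 0)) n = fps_nth (
    fps_artanh / (2 * (1 - fps_X)) + fps_const a * (fps_X ^ 2 / (1 - fps_X)) +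
      (fps_const b * fps_X + fps_const c) * fps_artanh + fps_const d * fps_X) n"
    by (simp add: e fps_divide_fps_X_minus1_sum distrib_right mult.assoc)
       (simp add: fps_artanh_def fps_X_nth)
qed

lemma artanh_sums:
  fixes z :: complex
  assumes "norm z < 1"
  shows "(\<lambda>n. of_bool (odd n) / of_nat n * z ^ n) sums artanh z"
proof -
  have z: "norm (- z) < 1" using assms by simp
  have "\<bar>Re z\<bar> < 1" using assms abs_Re_le_cmod[of z] by linarith
  then have re: "Re (1 + z) > 0" "Re (1 - z) > 0" by auto
  then have nz: "1 + z \<noteq> 0" "1 - z \<noteq> 0" by fastforce+
  \<comment> \<open>On the unit disc both 1 + z and 1 - z have positive real part. The difference of
    their logarithms therefore has imaginary part strictly between -pi and pi and is the principal
    logarithm of the quotient.\<close>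
  have "\<bar>Im (Ln (1 + z))\<bar> < pi / 2" "\<bar>Im (Ln (1 - z))\<bar> < pi / 2"
    using re by (intro Re_Ln_pos_lt_imp; simp)+
  then have "Ln ((1 + z) / (1 - z)) = Ln (1 + z) - Ln (1 - z)"
    using nz by (intro Ln_unique) (auto simp: exp_diff)
  moreover have "(\<lambda>n. (-1) ^ Suc n / of_nat n * z ^ n - (-1) ^ Suc n / of_nat n * (- z) ^ n) sums
      (Ln (1 + z) - Ln (1 - z))"
    using sums_diff[OF Ln_series[OF assms] Ln_series[OF z]] by simp
  then have "(\<lambda>n. ((-1) ^ Suc n / of_nat n * z ^ n - (-1) ^ Suc n / of_nat n * (- z) ^ n) / 2) sums
      ((Ln (1 + z) - Ln (1 - z)) / 2)"
    by (rule sums_divide)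
  moreover have "((-1) ^ Suc n / of_nat n * z ^ n - (-1) ^ Suc n / of_nat n * (- z) ^ n) / 2 =
      of_bool (odd n) / of_nat n * z ^ n" for n
    by (cases "even n") (auto simp: power_minus_odd)
  ultimately show ?thesis by (simp add: artanh_def)
qed

lemma summable_norm_artanh:
  fixes z :: complex
  assumes "norm z < 1"
  shows "summable (\<lambda>n. norm (of_bool (odd n) / of_nat n * z ^ n))"
proof (rule summable_comparison_test'[of "\<lambda>n. norm z ^ n" 0])
  show "summable (\<lambda>n. norm z ^ n)" using assms by (simp add: summable_geometric)
  show "norm (norm (of_bool (odd n) / of_nat n * z ^ n)) \<le> norm z ^ n" for n
  proof -
    have "norm (of_bool (odd n) / of_nat n :: complex) \<le> 1"
      by (cases "n = 0") (auto simp: norm_divide divide_simps)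
    then have "norm (of_bool (odd n) / of_nat n * z ^ n) \<le> 1 * norm z ^ n"
      unfolding norm_mult norm_power by (rule mult_right_mono) simp
    then show ?thesis by (simp only: real_norm_def abs_norm_cancel mult_1)
  qed
qed

text \<open>The analytic counterpart of dividing by 1 - X: a Cauchy product with the geometric
  series.\<close>

lemma H_odd_sums:
  fixes z :: complex
  assumes "norm z < 1"
  shows "(\<lambda>n. of_real (H_odd n) * z ^ n) sums (artanh z / (1 - z))"
proof -
  have geo: "summable (\<lambda>n. norm (z ^ n))" using assms by (simp add: norm_power summable_geometric)
  have "of_real (H_odd n) * z ^ n = (\<Sum>i\<le>n. of_bool (odd i) / of_nat i * z ^ i * z ^ (n - i))" for n
  proof -
    have "of_real (H_odd n) = (\<Sum>i\<le>n. of_bool (odd i) / of_nat i :: complex)"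
      by (simp add: H_odd_def atMost_atLeast0 sum.atLeast_Suc_atMost)
         (intro sum.cong; simp)
    then show ?thesis
      by (auto simp: sum_distrib_right mult.assoc simp flip: power_add intro!: sum.cong)
  qed
  then show ?thesis
    using Cauchy_product_sums[OF summable_norm_artanh[OF assms] geo]
      sums_unique[OF artanh_sums[OF assms]] suminf_geometric[OF assms]
    by (simp add: divide_inverse)
qed

lemma has_sum_H_odd:
  fixes z :: complex
  assumes e: "\<And>n. (if n \<ge> 2 then e n else 0) =
      H_odd n / 2 + a * of_bool (n \<ge> 2) + b * (of_bool (odd (n - 1)) / real (n - 1)) +
      c * (of_bool (odd n) / real n) + d * of_bool (n = 1)"
    and nonneg: "\<And>n. e n \<ge> 0" and z: "norm z < 1"
  shows "((\<lambda>n. of_real (e n) * z ^ n) has_sum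
    (artanh z / (2 * (1 - z)) + of_real a * (z ^ 2 / (1 - z)) +
      (of_real b * z + of_real c) * artanh z + of_real d * z)) {2..}"
proof -
  define f where "f n = (if n \<ge> 2 then e n else 0)" for n
  have sums: "(\<lambda>n. of_real (f n) * z ^ n) sums
    (artanh z / (2 * (1 - z)) + of_real a * (z ^ 2 / (1 - z)) +
      (of_real b * z + of_real c) * artanh z + of_real d * z)" if z: "norm z < 1" for z :: complex
  proof -
    have 1: "(\<lambda>n. of_bool (n \<ge> 2) * z ^ n) sums (z ^ 2 / (1 - z))"
      using sums_mult[OF geometric_sums[OF z], of "z ^ 2"]
      by (subst sums_iff_shift'[of _ 2, symmetric]) (simp add: power_add power2_eq_square lessThan_Suc numeral_2_eq_2 mult_ac)
    have 2: "(\<lambda>n. of_bool (odd (n - 1)) / of_nat (n - 1) * z ^ n) sums (z * artanh z)"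
      using sums_mult[OF artanh_sums[OF z], of z]
        sums_Suc[of "\<lambda>n. of_bool (odd (n - 1)) / of_nat (n - 1) * z ^ n" "z * artanh z"]
      by (simp add: mult_ac)
    have 3: "(\<lambda>n. of_bool (n = 1) * z ^ n) sums z"
    proof -
      have "(\<lambda>n. of_bool (n = 1) * z ^ n) = (\<lambda>n. if n = 1 then z ^ n else 0)" by auto
      with sums_single[of 1 "\<lambda>n. z ^ n"] show ?thesis by simp
    qed
    have "(\<lambda>n. of_real (H_odd n) * z ^ n / 2 + of_real a * (of_bool (n \<ge> 2) * z ^ n) +
        (of_real b * (of_bool (odd (n - 1)) / of_nat (n - 1) * z ^ n) +
         of_real c * (of_bool (odd n) / of_nat n * z ^ n)) + of_real d * (of_bool (n = 1) * z ^ n)) sums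
      (artanh z / (1 - z) / 2 + of_real a * (z ^ 2 / (1 - z)) +
        (of_real b * (z * artanh z) + of_real c * artanh z) + of_real d * z)"
      by (intro sums_add sums_mult sums_divide H_odd_sums artanh_sums 1 2 3 z)
    moreover have "of_real (f n) * z ^ n = of_real (H_odd n) * z ^ n / 2 + of_real a * (of_bool (n \<ge> 2) * z ^ n) +
        (of_real b * (of_bool (odd (n - 1)) / of_nat (n - 1) * z ^ n) +
         of_real c * (of_bool (odd n) / of_nat n * z ^ n)) + of_real d * (of_bool (n = 1) * z ^ n)" for n
    proof -
      have "complex_of_real (of_bool P) = of_bool P" for P by (cases P) auto
      then show ?thesis
        by (simp add: f_def e distrib_right add.assoc mult.assoc)
    qed
    ultimately show ?thesis by (simp add: algebra_simps)
  qed
  \<comment> \<open>\<open>has_sum\<close> means unconditional summation. Since the coefficients are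
    nonnegative, convergence at the real point \<open>norm z\<close> already is absolute convergence
    at \<open>z\<close>.\<close>
  have "summable (\<lambda>n. norm (of_real (f n) * z ^ n))"
  proof -
    have "norm (of_real (norm z) :: complex) < 1" using z by simp
    from sums_summable[OF sums[OF this]] have "summable (\<lambda>n. complex_of_real (f n * norm z ^ n))" by simp
    then have "summable (\<lambda>n. f n * norm z ^ n)" by (simp only: summable_complex_of_real)
    then show ?thesis using nonneg by (simp add: norm_mult norm_power f_def)
  qed
  from norm_summable_imp_has_sum[OF this sums[OF z]] show ?thesis
    by (rule has_sum_cong_neutral[THEN iffD1, rotated -1]) (auto simp: f_def)
qed

section \<open>Asymptotic comparison\<close>

lemma bigo_of_increments:
  fixes u v :: "nat \<Rightarrow> real"
  assumes u: "u \<longlonglongrightarrow> 0" and v: "v \<longlonglongrightarrow> 0"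
    and decr: "eventually (\<lambda>n. v (Suc n) \<le> v n) sequentially"
    and incr: "(\<lambda>n. u (Suc n) - u n) \<in> O(\<lambda>n. v n - v (Suc n))"
  shows "u \<in> O(v)"
proof -
  from incr obtain C where C: "C > 0" "eventually (\<lambda>n. \<bar>u (Suc n) - u n\<bar> \<le> C * \<bar>v n - v (Suc n)\<bar>) sequentially"
    by (auto elim!: landau_o.bigE)
  from eventually_conj[OF decr C(2)] obtain N where N:
    "\<And>n. n \<ge> N \<Longrightarrow> v (Suc n) \<le> v n \<and> \<bar>u (Suc n) - u n\<bar> \<le> C * \<bar>v n - v (Suc n)\<bar>"
    by (auto simp: eventually_sequentially)
  have "\<bar>u n\<bar> \<le> C * v n" if n: "n \<ge> N" for n
  proof -
    \<comment> \<open>The increment bounds telescope on both sides, monotonicity of \<open>v\<close>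
      having removed the absolute value. Letting k tend to infinity then deletes
      \<open>u (n + k)\<close> and \<open>v (n + k)\<close>.\<close>
    have le: "\<bar>u n - u (n + k)\<bar> \<le> C * (v n - v (n + k))" for k
    proof (induction k)
      case (Suc k)
      have "\<bar>u (Suc (n + k)) - u (n + k)\<bar> \<le> C * (v (n + k) - v (Suc (n + k)))"
        using N[of "n + k"] n abs_of_nonneg[of "v (n + k) - v (Suc (n + k))"] by auto
      with Suc show ?case by (simp add: algebra_simps)
    qed simp
    have lim_u: "(\<lambda>k. \<bar>u n - u (n + k)\<bar>) \<longlonglongrightarrow> \<bar>u n - 0\<bar>"
      using LIMSEQ_ignore_initial_segment[OF u, of n] by (intro tendsto_intros) (simp add: add.commute)
    have lim_v: "(\<lambda>k. C * (v n - v (n + k))) \<longlonglongrightarrow> C * (v n - 0)"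
      using LIMSEQ_ignore_initial_segment[OF v, of n] by (intro tendsto_intros) (simp add: add.commute)
    from le LIMSEQ_le[OF lim_u lim_v] show ?thesis by simp
  qed
  moreover have "C * v n \<le> C * \<bar>v n\<bar>" for n
    using C(1) by simp
  ultimately have "\<bar>u n\<bar> \<le> C * \<bar>v n\<bar>" if "n \<ge> N" for n
    using that order_trans by blast
  then show ?thesis
    by (intro bigoI[of _ C]) (auto simp: eventually_sequentially)
qed

text \<open>Along n = 2k and n = 2k + 1 the indicators of even n become constants, which leaves
  expressions in k that \<open>real_asymp\<close> can expand.\<close>

lemma bigo_parity:
  fixes f g :: "nat \<Rightarrow> real"
  assumes "(\<lambda>k. f (2 * k)) \<in> O(\<lambda>k. g (2 * k))" "(\<lambda>k. f (2 * k + 1)) \<in> O(\<lambda>k. g (2 * k + 1))"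
  shows "f \<in> O(g)"
proof -
  from assms(1) obtain C where "C > 0" "eventually (\<lambda>k. norm (f (2 * k)) \<le> C * norm (g (2 * k))) sequentially"
    by (auto elim!: landau_o.bigE)
  then obtain M where M: "\<And>k. k \<ge> M \<Longrightarrow> norm (f (2 * k)) \<le> C * norm (g (2 * k))"
    by (auto simp: eventually_sequentially)
  from assms(2) obtain D where "D > 0" "eventually (\<lambda>k. norm (f (2 * k + 1)) \<le> D * norm (g (2 * k + 1))) sequentially"
    by (auto elim!: landau_o.bigE)
  then obtain N where N: "\<And>k. k \<ge> N \<Longrightarrow> norm (f (2 * k + 1)) \<le> D * norm (g (2 * k + 1))"
    by (auto simp: eventually_sequentially)
  have "norm (f n) \<le> max C D * norm (g n)" if "n \<ge> 2 * M + 2 * N" for n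
  proof (cases "even n")
    case True
    then obtain k where "n = 2 * k" by blast
    with that M[of k] have "norm (f n) \<le> C * norm (g n)" by simp
    also have "\<dots> \<le> max C D * norm (g n)" by (intro mult_right_mono) auto
    finally show ?thesis .
  next
    case False
    then obtain k where "n = 2 * k + 1" by (blast elim: oddE)
    with that N[of k] have "norm (f n) \<le> D * norm (g n)" by simp
    also have "\<dots> \<le> max C D * norm (g n)" by (intro mult_right_mono) auto
    finally show ?thesis .
  qed
  then show ?thesis
    by (intro bigoI[of _ "max C D"]) (auto simp: eventually_sequentially)
qed

text \<open>The even terms of the harmonic sum up to 2k make up half of the harmonic sum up to
  k.\<close>

lemma H_odd_even_eq_harm: "H_odd (2 * k) = harm (2 * k) - harm k / 2"
proof (induction k)
  case (Suc k)
  have "inverse (real (Suc (Suc (2 * k)))) = inverse (real (Suc k)) / 2"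
    by (simp add: field_simps)
  with Suc.IH show ?case
    by (simp add: H_odd_Suc harm_Suc add_divide_distrib inverse_eq_divide)
qed (simp add: harm_def)

text \<open>The terms are those of harm(2k) - harm(k) / 2 when harm(n) is expanded as ln n +
  \<gamma> + 1 / (2n) - 1 / (12 n^2) + O(1 / n^4): the 1/k terms cancel and -1/48 + 1/24 = 1/48
  remains. The limit defining \<gamma> fixes the constant; the increments give the order of the
  error.\<close>

lemma H_odd_even_asymp:
  "(\<lambda>k. H_odd (2 * k) - (ln (real k) / 2 + ln 2 + euler_mascheroni / 2 + 1 / (48 * real k ^ 2)))
     \<in> O(\<lambda>k. 1 / real k ^ 4)"
proof (rule bigo_of_increments)
  have lim: "(\<lambda>k. (harm (2 * k) - ln (real (2 * k))) - (harm k - ln (real k)) / 2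
      - euler_mascheroni / 2 - 1 / (48 * real k ^ 2)) \<longlonglongrightarrow>
      euler_mascheroni - euler_mascheroni / 2 - euler_mascheroni / 2 - (0 :: real)"
  proof (intro tendsto_diff tendsto_divide tendsto_const euler_mascheroni_LIMSEQ)
    show "(\<lambda>k. harm (2 * k) - ln (real (2 * k)) :: real) \<longlonglongrightarrow> euler_mascheroni"
      by (rule filterlim_compose[OF euler_mascheroni_LIMSEQ]) (auto simp: filterlim_subseq strict_mono_def)
    show "(\<lambda>k. 1 / (48 * real k ^ 2)) \<longlonglongrightarrow> 0" by real_asymp
  qed auto
  have "eventually (\<lambda>k. (harm (2 * k) - ln (real (2 * k))) - (harm k - ln (real k)) / 2
      - euler_mascheroni / 2 - 1 / (48 * real k ^ 2) = H_odd (2 * k) -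
      (ln (real k) / 2 + ln 2 + euler_mascheroni / 2 + 1 / (48 * real k ^ 2))) sequentially"
    using eventually_gt_at_top[of 0]
    by eventually_elim (simp add: H_odd_even_eq_harm ln_mult diff_divide_distrib)
  from Lim_transform_eventually[OF lim this] show "(\<lambda>k. H_odd (2 * k) -
      (ln (real k) / 2 + ln 2 + euler_mascheroni / 2 + 1 / (48 * real k ^ 2))) \<longlonglongrightarrow> 0"
    by simp
  show "(\<lambda>k. 1 / real k ^ 4) \<longlonglongrightarrow> 0" by real_asymp
  show "eventually (\<lambda>k. 1 / real (Suc k) ^ 4 \<le> 1 / real k ^ 4) sequentially" by real_asymp
  \<comment> \<open>\<open>H_odd\<close> gains 1 / (2k + 1) from 2k to 2k + 2. Its expansion matches
    this up to order k^(-5), the order of the increments of 1 / k^4.\<close>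
  have "(\<lambda>k. 1 / (2 * real k + 1) - (ln (real k + 1) / 2 - ln (real k) / 2)
      - (1 / (48 * (real k + 1) ^ 2) - 1 / (48 * real k ^ 2)))
      \<in> O(\<lambda>k. 1 / real k ^ 4 - 1 / (real k + 1) ^ 4)"
    by real_asymp
  then show "(\<lambda>k. H_odd (2 * Suc k) -
      (ln (real (Suc k)) / 2 + ln 2 + euler_mascheroni / 2 + 1 / (48 * real (Suc k) ^ 2)) -
      (H_odd (2 * k) - (ln (real k) / 2 + ln 2 + euler_mascheroni / 2 + 1 / (48 * real k ^ 2))))
      \<in> O(\<lambda>k. 1 / real k ^ 4 - 1 / real (Suc k) ^ 4)"
    by (simp add: H_odd_Suc algebra_simps)
qed

section \<open>Closed forms, generating functions and asymptotics\<close>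

lemma E_up_sum:
  assumes "n \<ge> 2"
  shows "E_up n = 1 / (2 * real (n choose 2)) * (\<Sum>m=0..n-2. real (m + 1) * H_odd m)"
  unfolding E_up_def expectation_random_path[OF assms] mean_up_to_zero
  by (simp flip: sum_divide_distrib)

lemma E_down_sum:
  assumes "n \<ge> 2"
  shows "E_down n = 1 / (2 * real (n choose 2)) * (\<Sum>m=0..n-2. real (m + 1) * (H_odd (m + 1) - 1))"
  unfolding E_down_def expectation_random_path[OF assms] mean_down_from_zero
  by (simp flip: sum_divide_distrib)

lemma E_up_closed:
  assumes "n \<ge> 2"
  shows "E_up n = 1/2 * H_odd (n - 2) - 1/8 + (-1) ^ n / (8 * (real n - of_bool (even n)))"
proof -
  obtain j where n: "n = j + 2" using assms by (metis add.commute le_Suc_ex)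
  have "real (n choose 2) \<noteq> 0" using assms by simp
  moreover define K where "K = real (n choose 2)"
  moreover have "E_up n = 1 / (2 * K) * (K * (H_odd j - 1/4 + (-1) ^ j / (4 * (real (j + 2) - of_bool (even j)))))"
    using E_up_sum[OF assms] sum_weighted_H_odd[of j] by (simp add: n K_def)
  ultimately show ?thesis by (simp add: n diff_divide_distrib add_divide_distrib)
qed

text \<open>Compared with the sum for \<open>E_up\<close>, each summand gains [m even] - (m + 1).
  The part m + 1 sums to \<open>n choose 2\<close> and yields -1/2; counting the even m yields the
  last fraction.\<close>

lemma E_down_closed:
  assumes "n \<ge> 2"
  shows "E_down n = E_up n - 1/2 + 1 / (2 * (real n - of_bool (even n)))"
proof -
  obtain j where n: "n = j + 2" using assms by (metis add.commute le_Suc_ex)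
  define K where "K = real (n choose 2)"
  have K: "K = real (j + 2) * real (j + 1) / 2"
    unfolding K_def n by (rule real_choose_two)
  have K0: "K \<noteq> 0" using assms by (simp add: K_def)
  have "(\<Sum>m=0..j. real (m + 1) * (H_odd (m + 1) - 1)) =
      (\<Sum>m=0..j. real (m + 1) * H_odd m + of_bool (even m) - real (m + 1))"
    by (intro sum.cong refl) (simp add: H_odd_Suc algebra_simps)
  also have "\<dots> = (\<Sum>m=0..j. real (m + 1) * H_odd m) + (real (j div 2) + 1) - K"
  proof -
    have "(\<Sum>m=0..j. real (m + 1)) = K"
      using sum_Suc_eq_choose_two[of "Suc j"] by (simp add: K_def n atLeast0AtMost lessThan_Suc_atMost)
    then show ?thesis by (simp only: sum_subtractf sum.distrib sum_even_indicator)
  qed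
  finally have "E_down n = 1 / (2 * K) * ((\<Sum>m=0..j. real (m + 1) * H_odd m) + (real (j div 2) + 1) - K)"
    using E_down_sum[OF assms] by (simp add: n K_def)
  moreover have "E_up n = 1 / (2 * K) * (\<Sum>m=0..j. real (m + 1) * H_odd m)"
    using E_up_sum[OF assms] by (simp add: n K_def)
  ultimately have "E_down n = E_up n - 1/2 + (real (j div 2) + 1) / (2 * K)"
    using K0 by (simp add: field_simps)
  moreover have "(real (j div 2) + 1) / (2 * K) = 1 / (2 * (real n - of_bool (even n)))"
  proof (cases "even j")
    case True
    then obtain i where "j = 2 * i" by blast
    then show ?thesis by (simp add: K n divide_simps) (simp add: algebra_simps)
  next
    case False
    then obtain i where "j = 2 * i + 1" by (blast elim: oddE)
    then show ?thesis by (simp add: K n divide_simps) (simp add: algebra_simps)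
  qed
  ultimately show ?thesis by simp
qed

text \<open>Passing from \<open>H_odd (n - 2)\<close> to \<open>H_odd n\<close> costs 1/2 at n - 1
  or n, whichever is odd. With the parity term of the closed form this gives -1/2 + 1/8 = -3/8 and
  -1/2 - 1/8 = -5/8. At n = 1 the remainder 1/2 - 5/8 is cancelled by 1/8.\<close>

lemma E_up_coeff:
  "(if n \<ge> 2 then E_up n else 0) =
    H_odd n / 2 + (- 1/8) * of_bool (n \<ge> 2) + (- 3/8) * (of_bool (odd (n - 1)) / real (n - 1)) +
    (- 5/8) * (of_bool (odd n) / real n) + (1/8) * of_bool (n = 1)"
proof -
  consider "n = 0" | "n = 1" | j where "n = j + 2"
    by (metis One_nat_def Suc_1 add_2_eq_Suc' not0_implies_Suc)
  then show ?thesis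
  proof cases
    case 3
    then show ?thesis
      by (cases "even j") (simp_all add: E_up_closed H_odd_Suc add_divide_distrib, simp_all add: divide_simps)
  qed (simp_all add: H_odd_Suc)
qed

lemma E_down_coeff:
  "(if n \<ge> 2 then E_down n else 0) =
    H_odd n / 2 + (- 5/8) * of_bool (n \<ge> 2) + (1/8) * (of_bool (odd (n - 1)) / real (n - 1)) +
    (- 1/8) * (of_bool (odd n) / real n) + (- 3/8) * of_bool (n = 1)"
proof (cases "n \<ge> 2")
  case True
  define y where "y = real n - of_bool (even n)"
  have "y > 0" using True by (cases "even n") (simp_all add: y_def)
  then have "E_down n = E_up n - 1/2 + 1/2 * (1 / y)"
    using E_down_closed[OF True] by (simp add: y_def)
  moreover define A B where "A = of_bool (odd (n - 1)) / real (n - 1)" and "B = of_bool (odd n) / real n"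
  \<comment> \<open>Exactly one of n - 1 and n is odd, and it equals y. Adding -1/2 + (A + B) / 2
    thus raises both fractional coefficients of \<open>E_up\<close> by 1/2.\<close>
  moreover have "1 / y = A + B"
    using True by (cases "even n") (simp_all add: y_def A_def B_def of_nat_diff)
  moreover have "E_up n = H_odd n / 2 - 1/8 - 3/8 * A - 5/8 * B"
    using E_up_coeff[of n, folded A_def B_def] True by simp
  ultimately show ?thesis
    using True unfolding A_def[symmetric] B_def[symmetric] by (simp add: field_simps)
next
  case False
  then have "n = 0 \<or> n = 1" by auto
  then show ?thesis by (auto simp: H_odd_Suc)
qed

lemma E_nonneg: "E_up n \<ge> 0" "E_down n \<ge> 0"
  unfolding E_up_def E_down_def by (intro Bochner_Integration.integral_nonneg; simp)+

text \<open>Isolates the only part that is not an explicit function of k; the remainder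
  \<open>r\<close> can be expanded directly.\<close>

lemma bigo_of_H_odd_even:
  fixes f r g :: "nat \<Rightarrow> real"
  assumes f: "eventually (\<lambda>k. f k = (H_odd (2 * k) -
      (ln (real k) / 2 + ln 2 + euler_mascheroni / 2 + 1 / (48 * real k ^ 2))) / 2 + r k) sequentially"
    and g: "(\<lambda>k. 1 / real k ^ 4) \<in> O(g)" and r: "r \<in> O(g)"
  shows "f \<in> O(g)"
proof -
  have "(\<lambda>k. (H_odd (2 * k) -
      (ln (real k) / 2 + ln 2 + euler_mascheroni / 2 + 1 / (48 * real k ^ 2))) / 2) \<in> O(g)"
    using landau_o.big_trans[OF H_odd_even_asymp g] by simp
  from sum_in_bigo(1)[OF this r] show ?thesis
    by (subst landau_o.big.in_cong[OF f])
qed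

lemma E_up_asymp:
  "(\<lambda>n. E_up n -
    (1/4 * ln (real n) + (2 * euler_mascheroni + 2 * ln 2 - 1) / 8 - 3 / (8 * real n)
      - (3 * of_bool (even n) + 1) / (12 * real n ^ 2)
      - 3 * of_bool (even n) / (8 * real n ^ 3))) \<in> O(\<lambda>n. 1 / real n ^ 4)"
proof (rule bigo_parity)
  show "(\<lambda>k. E_up (2 * k) -
    (1/4 * ln (real (2 * k)) + (2 * euler_mascheroni + 2 * ln 2 - 1) / 8 - 3 / (8 * real (2 * k))
      - (3 * of_bool (even (2 * k)) + 1) / (12 * real (2 * k) ^ 2)
      - 3 * of_bool (even (2 * k)) / (8 * real (2 * k) ^ 3))) \<in> O(\<lambda>k. 1 / real (2 * k) ^ 4)"
  proof (rule bigo_of_H_odd_even)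
    show "eventually (\<lambda>k. E_up (2 * k) -
      (1/4 * ln (real (2 * k)) + (2 * euler_mascheroni + 2 * ln 2 - 1) / 8 - 3 / (8 * real (2 * k))
        - (3 * of_bool (even (2 * k)) + 1) / (12 * real (2 * k) ^ 2)
        - 3 * of_bool (even (2 * k)) / (8 * real (2 * k) ^ 3)) =
      (H_odd (2 * k) - (ln (real k) / 2 + ln 2 + euler_mascheroni / 2 + 1 / (48 * real k ^ 2))) / 2 +
      (1 / (96 * real k ^ 2) - 3 / (8 * (2 * real k - 1)) + 3 / (16 * real k)
        + 1 / (12 * real k ^ 2) + 3 / (64 * real k ^ 3))) sequentially"
      using eventually_gt_at_top[of 0]
    proof eventually_elim
      case (elim k)
      have "real (2 * k - 1) = 2 * real k - 1" using elim by (simp add: of_nat_diff)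
      then have "E_up (2 * k) = H_odd (2 * k) / 2 - 1/8 - 3 / (8 * (2 * real k - 1))"
        using E_up_coeff[of "2 * k"] elim by simp
      then show ?case
        using elim by (simp add: ln_mult power_mult_distrib add_divide_distrib diff_divide_distrib)
    qed
    show "(\<lambda>k. 1 / (96 * real k ^ 2) - 3 / (8 * (2 * real k - 1)) + 3 / (16 * real k)
        + 1 / (12 * real k ^ 2) + 3 / (64 * real k ^ 3)) \<in> O(\<lambda>k. 1 / real (2 * k) ^ 4)"
      by real_asymp
  qed real_asymp
  show "(\<lambda>k. E_up (2 * k + 1) -
    (1/4 * ln (real (2 * k + 1)) + (2 * euler_mascheroni + 2 * ln 2 - 1) / 8 - 3 / (8 * real (2 * k + 1))
      - (3 * of_bool (even (2 * k + 1)) + 1) / (12 * real (2 * k + 1) ^ 2)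
      - 3 * of_bool (even (2 * k + 1)) / (8 * real (2 * k + 1) ^ 3))) \<in> O(\<lambda>k. 1 / real (2 * k + 1) ^ 4)"
  proof (rule bigo_of_H_odd_even)
    show "eventually (\<lambda>k. E_up (2 * k + 1) -
      (1/4 * ln (real (2 * k + 1)) + (2 * euler_mascheroni + 2 * ln 2 - 1) / 8 - 3 / (8 * real (2 * k + 1))
        - (3 * of_bool (even (2 * k + 1)) + 1) / (12 * real (2 * k + 1) ^ 2)
        - 3 * of_bool (even (2 * k + 1)) / (8 * real (2 * k + 1) ^ 3)) =
      (H_odd (2 * k) - (ln (real k) / 2 + ln 2 + euler_mascheroni / 2 + 1 / (48 * real k ^ 2))) / 2 +
      (ln (real k) / 4 + ln 2 / 4 - ln (2 * real k + 1) / 4 + 1 / (96 * real k ^ 2)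
        - 1 / (8 * (2 * real k + 1)) + 3 / (8 * (2 * real k + 1)) + 1 / (12 * (2 * real k + 1) ^ 2))) sequentially"
      using eventually_gt_at_top[of 0]
    proof eventually_elim
      case (elim k)
      define y where "y = real (2 * k + 1)"
      have y: "2 * real k + 1 = y" by (simp add: y_def)
      have "H_odd (2 * k + 1) = H_odd (2 * k) + 1 / y"
        by (simp add: H_odd_Suc y_def)
      \<comment> \<open>The last term 1/y of \<open>H_odd (2 * k + 1)\<close> enters with 1/2 and
        the odd-index coefficient is -5/8, which leaves -1/8.\<close>
      then have E: "E_up (2 * k + 1) = H_odd (2 * k) / 2 - 1/8 - 1 / (8 * y)"
        using E_up_coeff[of "2 * k + 1", folded y_def] elim by (simp add: add_divide_distrib)
      show ?case
        unfolding E y y_def[symmetric] by (simp add: add_divide_distrib diff_divide_distrib)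
    qed
    show "(\<lambda>k. ln (real k) / 4 + ln 2 / 4 - ln (2 * real k + 1) / 4 + 1 / (96 * real k ^ 2)
        - 1 / (8 * (2 * real k + 1)) + 3 / (8 * (2 * real k + 1)) + 1 / (12 * (2 * real k + 1) ^ 2))
        \<in> O(\<lambda>k. 1 / real (2 * k + 1) ^ 4)"
      by real_asymp
  qed real_asymp
qed

lemma E_down_asymp:
  "(\<lambda>n. E_down n -
    (1/4 * ln (real n) + (2 * euler_mascheroni + 2 * ln 2 - 5) / 8 + 1 / (8 * real n)
      + (3 * of_bool (even n) - 1) / (12 * real n ^ 2)
      + of_bool (even n) / (8 * real n ^ 3))) \<in> O(\<lambda>n. 1 / real n ^ 4)"
proof -
  define R where "R n = E_up n -
    (1/4 * ln (real n) + (2 * euler_mascheroni + 2 * ln 2 - 1) / 8 - 3 / (8 * real n)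
      - (3 * of_bool (even n) + 1) / (12 * real n ^ 2)
      - 3 * of_bool (even n) / (8 * real n ^ 3))" for n
  \<comment> \<open>For even n this is the error of 1 / (2 (n - 1)) against the first three terms of
    its geometric expansion in 1/n; for odd n it is 0.\<close>
  define S where "S n = 1 / (2 * (real n - of_bool (even n))) -
    (1 / (2 * real n) + of_bool (even n) / (2 * real n ^ 2) + of_bool (even n) / (2 * real n ^ 3))" for n
  have "S \<in> O(\<lambda>n. 1 / real n ^ 4)"
  proof (rule bigo_parity)
    have "(\<lambda>k. 1 / (2 * (2 * real k - 1)) - (1 / (4 * real k) + 1 / (2 * (2 * real k) ^ 2) +
        1 / (2 * (2 * real k) ^ 3))) \<in> O(\<lambda>k. 1 / (2 * real k) ^ 4)" by real_asymp
    then show "(\<lambda>k. S (2 * k)) \<in> O(\<lambda>k. 1 / real (2 * k) ^ 4)" by (simp add: S_def)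
  qed (simp add: S_def)
  from sum_in_bigo(1)[OF E_up_asymp[folded R_def] this]
  have "(\<lambda>n. R n + S n) \<in> O(\<lambda>n. 1 / real n ^ 4)" .
  moreover have "eventually (\<lambda>n. E_down n -
    (1/4 * ln (real n) + (2 * euler_mascheroni + 2 * ln 2 - 5) / 8 + 1 / (8 * real n)
      + (3 * of_bool (even n) - 1) / (12 * real n ^ 2)
      + of_bool (even n) / (8 * real n ^ 3)) = R n + S n) sequentially"
    using eventually_ge_at_top[of 2]
  proof eventually_elim
    case (elim n)
    define p where "p = (of_bool (even n) :: real)"
    define t where "t = 1 / (2 * (real n - p))"
    \<comment> \<open>With the inverse powers of n as atoms, the identity becomes a comparison of
      coefficients.\<close>
    define q where "q k = 1 / real n ^ k" for k
    have q: "a / (b * real n ^ k) = a / b * q k" "a / (b * real n) = a / b * q 1" for a b k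
      by (simp_all add: q_def)
    have "E_down n = E_up n - 1/2 + t" using E_down_closed[OF elim] by (simp add: t_def p_def)
    then show ?case
      unfolding R_def S_def p_def[symmetric]
      unfolding t_def[symmetric] q by (simp add: field_simps)
  qed
  ultimately show ?thesis by (simp add: landau_o.big.in_cong)
qed

theorem propositionG1:
  shows
    "(\<forall>n\<ge>2.
        E_up n = 1 / (2 * real (n choose 2)) *
          (\<Sum>n'=0..n-2. \<Sum>m=1..n'. of_bool (odd m) * (real (n' + 1) / real m)) \<and>
        E_up n = 1/2 * H_odd (n - 2) - 1/8 + (-1) ^ n / (8 * (real n - of_bool (even n)))) \<and>
     (\<forall>n\<ge>2.
        E_down n = 1 / (2 * real (n choose 2)) *
          (\<Sum>n'=0..n-2. \<Sum>m=3..n'+1. of_bool (odd m) * (real (n' + 1) / real m)) \<and>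
        E_down n = E_up n - 1/2 + 1 / (2 * (real n - of_bool (even n)))) \<and>
     Abs_fps (\<lambda>n. if n \<ge> 2 then E_up n else 0) =
       fps_artanh / (2 * (1 - fps_X)) - fps_X ^ 2 / (8 * (1 - fps_X))
         - (3 * fps_X + 5) / 8 * fps_artanh + fps_X / 8 \<and>
     Abs_fps (\<lambda>n. if n \<ge> 2 then E_down n else 0) =
       fps_artanh / (2 * (1 - fps_X)) - 5 * fps_X ^ 2 / (8 * (1 - fps_X))
         + (fps_X - 1) / 8 * fps_artanh - 3 * fps_X / 8 \<and>
     (\<forall>z::complex. norm z < 1 \<longrightarrow>
        ((\<lambda>n. complex_of_real (E_up n) * z ^ n) has_sum
          (artanh z / (2 * (1 - z)) - z ^ 2 / (8 * (1 - z))
            - (3 * z + 5) / 8 * artanh z + z / 8)) {2..} \<and>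
        ((\<lambda>n. complex_of_real (E_down n) * z ^ n) has_sum
          (artanh z / (2 * (1 - z)) - 5 * z ^ 2 / (8 * (1 - z))
            + (z - 1) / 8 * artanh z - 3 * z / 8)) {2..}) \<and>
     (\<lambda>n. E_up n -
        (1/4 * ln (real n) + (2 * euler_mascheroni + 2 * ln 2 - 1) / 8 - 3 / (8 * real n)
          - (3 * of_bool (even n) + 1) / (12 * real n ^ 2)
          - 3 * of_bool (even n) / (8 * real n ^ 3))) \<in> O(\<lambda>n. 1 / real n ^ 4) \<and>
     (\<lambda>n. E_down n -
        (1/4 * ln (real n) + (2 * euler_mascheroni + 2 * ln 2 - 5) / 8 + 1 / (8 * real n)
          + (3 * of_bool (even n) - 1) / (12 * real n ^ 2)
          + of_bool (even n) / (8 * real n ^ 3))) \<in> O(\<lambda>n. 1 / real n ^ 4)"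
proof (intro conjI allI impI)
  fix n :: nat assume n: "n \<ge> 2"
  show "E_up n = 1 / (2 * real (n choose 2)) *
      (\<Sum>n'=0..n-2. \<Sum>m=1..n'. of_bool (odd m) * (real (n' + 1) / real m))"
    unfolding E_up_sum[OF n] H_odd_def sum_distrib_left
    by (intro sum.cong refl) simp
  show "E_up n = 1/2 * H_odd (n - 2) - 1/8 + (-1) ^ n / (8 * (real n - of_bool (even n)))"
    by (rule E_up_closed[OF n])
  show "E_down n = 1 / (2 * real (n choose 2)) *
      (\<Sum>n'=0..n-2. \<Sum>m=3..n'+1. of_bool (odd m) * (real (n' + 1) / real m))"
    unfolding E_down_sum[OF n] H_odd_minus_1[symmetric] sum_distrib_left
    by (intro sum.cong refl) simp
  show "E_down n = E_up n - 1/2 + 1 / (2 * (real n - of_bool (even n)))"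
    by (rule E_down_closed[OF n])
next
  \<comment> \<open>Power series do not form a field, so constant denominators are turned into
    factors \<open>fps_const (1 / c)\<close>, after which ring arithmetic suffices.\<close>
  note half = fps_divide_const_one_minus_X[where 'a = real]
  have quot: "f / fps_const c = fps_const (1 / c) * f" if "c \<noteq> 0" for f :: "real fps" and c
    using that by (simp add: fps_divide_unit fps_const_inverse inverse_eq_divide mult.commute)
  have const: "fps_const (- 1/8) = - fps_const (1/8 :: real)" "fps_const (- 3/8) = - fps_const (3/8 :: real)"
    "fps_const (- 5/8) = - fps_const (5/8 :: real)"
    by simp_all
  have e1: "fps_X ^ 2 / (8 * (1 - fps_X)) = fps_const (1/8) * (fps_X ^ 2 / (1 - fps_X :: real fps))"
    using half[of 8 "fps_X ^ 2"] by (simp add: numeral_fps_const)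
  have e2: "(3 * fps_X + 5) / 8 = fps_const (3/8) * fps_X + (fps_const (5/8) :: real fps)"
    using quot[of 8 "3 * fps_X + 5"] by (simp add: numeral_fps_const distrib_left mult.assoc[symmetric])
  have e3: "fps_X / 8 = fps_const (1/8) * (fps_X :: real fps)"
    using quot[of 8 fps_X] by (simp add: numeral_fps_const)
  have ring: "T + - c1 * Q + (- c3 * X + - c5) * A + c1 * X = T - c1 * Q - (c3 * X + c5) * A + c1 * X"
    for T Q X A c1 c3 c5 :: "real fps"
    by (simp add: algebra_simps)
  show "Abs_fps (\<lambda>n. if n \<ge> 2 then E_up n else 0) =
      fps_artanh / (2 * (1 - fps_X)) - fps_X ^ 2 / (8 * (1 - fps_X))
        - (3 * fps_X + 5) / 8 * fps_artanh + fps_X / 8"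
    unfolding Abs_fps_H_odd[OF E_up_coeff] const e1 e2 e3 by (rule ring)
  have "5 * fps_X ^ 2 / (8 * (1 - fps_X)) = fps_const (1/8) * ((fps_const 5 * fps_X ^ 2) / (1 - fps_X :: real fps))"
    using half[of 8 "fps_const 5 * fps_X ^ 2"] by (simp add: numeral_fps_const)
  also have "(fps_const 5 * fps_X ^ 2) / (1 - fps_X :: real fps) = fps_const 5 * (fps_X ^ 2 / (1 - fps_X))"
    by (simp add: fps_divide_unit mult.assoc)
  finally have d1: "5 * fps_X ^ 2 / (8 * (1 - fps_X)) = fps_const (5/8) * (fps_X ^ 2 / (1 - fps_X :: real fps))"
    by (simp add: mult.assoc[symmetric])
  have d2: "(fps_X - 1) / 8 = fps_const (1/8) * fps_X - (fps_const (1/8) :: real fps)"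
    using quot[of 8 "fps_X - 1"] by (simp add: numeral_fps_const right_diff_distrib)
  have d3: "3 * fps_X / 8 = fps_const (3/8) * (fps_X :: real fps)"
    using quot[of 8 "3 * fps_X"] by (simp add: numeral_fps_const mult.assoc[symmetric])
  have ring: "T + - c5 * Q + (c1 * X + - c1) * A + - c3 * X = T - c5 * Q + (c1 * X - c1) * A - c3 * X"
    for T Q X A c1 c3 c5 :: "real fps"
    by (simp add: algebra_simps)
  show "Abs_fps (\<lambda>n. if n \<ge> 2 then E_down n else 0) =
      fps_artanh / (2 * (1 - fps_X)) - 5 * fps_X ^ 2 / (8 * (1 - fps_X))
        + (fps_X - 1) / 8 * fps_artanh - 3 * fps_X / 8"
    unfolding Abs_fps_H_odd[OF E_down_coeff] const d1 d2 d3 by (rule ring)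
next
  fix z :: complex assume z: "norm z < 1"
  show "((\<lambda>n. complex_of_real (E_up n) * z ^ n) has_sum
      (artanh z / (2 * (1 - z)) - z ^ 2 / (8 * (1 - z))
        - (3 * z + 5) / 8 * artanh z + z / 8)) {2..}"
    using has_sum_H_odd[OF E_up_coeff E_nonneg(1) z] by (simp add: algebra_simps add_divide_distrib diff_divide_distrib)
  show "((\<lambda>n. complex_of_real (E_down n) * z ^ n) has_sum
      (artanh z / (2 * (1 - z)) - 5 * z ^ 2 / (8 * (1 - z))
        + (z - 1) / 8 * artanh z - 3 * z / 8)) {2..}"
    using has_sum_H_odd[OF E_down_coeff E_nonneg(2) z] by (simp add: algebra_simps add_divide_distrib diff_divide_distrib)
qed (rule E_up_asymp E_down_asymp)+

end
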